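(* Let $(\mathbf{Z},\mathbf{X})=((Z_1,\dots,Z_N),(X_1,\dots,X_N))$ consist of $N$ independent copies $(Z_i,X_i)$ of a pair $(Z,X)$ with values in $\{1,2\}\times\mathcal{X}$, where $\mathcal{X}$ is a measurable space, $Z$ is uniform on $\{1,2\}$, and, for $k=1,2$, the conditional law of $X$ given $Z=k$ has density $f_k$ with respect to a $\sigma$-finite measure $\mu$ on $\mathcal{X}$. Let $\mathbb{P}_2$ be the law of $\mathbf{X}$ and let $$\mathcal{R}=\left\{\mathbf{x}\in\mathcal{X}^N:\ \min\{f_1(x_i),f_2(x_i)\}>0\ \text{and}\ f_1(x_i)\ne f_2(x_i)\ \text{for all } i\in[N]\right\}.$$ Assume $\mathbb{P}_2(\mathcal{R})=1$. Let $\mathcal{T}$ be the class of measurable maps $\mathbf{t}:\mathcal{X}^N\to\{1,2\}^N$, and let $\tilde{\mathbf{t}}\in\mathcal{T}$ be the coordinatewise MAP estimator. Then $$\mathbb{E}\left[\mathrm{Ham}^*(\tilde{\mathbf{t}}(\mathbf{X}),\mathbf{Z})\right]=\min_{\mathbf{t}\in\mathcal{T}}\mathbb{E}\left[\mathrm{Ham}^*(\mathbf{t}(\mathbf{X}),\mathbf{Z})\right].$$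
   Context: The single-coordinate MAP estimator is a map $\tilde t:\mathcal{X}\to\{1,2\}$ with $\tilde t(x)\in\arg\max_{k\in\{1,2\}}f_k(x)$, with arbitrary measurable tie-breaking. The coordinatewise MAP estimator is $\tilde{\mathbf{t}}(\mathbf{x})=(\tilde t(x_1),\dots,\tilde t(x_N))$ for $\mathbf{x}=(x_1,\dots,x_N)\in\mathcal{X}^N$. For $\mathbf{z},\mathbf{w}\in\{1,2\}^N$, $\mathrm{Ham}(\mathbf{z},\mathbf{w})=\sum_{i=1}^N1(z_i\ne w_i)$ and $\mathrm{Ham}^*(\mathbf{z},\mathbf{w})=\min\{\mathrm{Ham}(\mathbf{z},\mathbf{w}),N-\mathrm{Ham}(\mathbf{z},\mathbf{w})\}$. $[N]=\{1,\dots,N\}$. *)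

theory Defs
  imports "HOL-Probability.Probability"
begin

text \<open>
  Points of \<open>\<X>\<^sup>N\<close> and of \<open>{1, 2}\<^sup>N\<close> are extensional functions on \<open>{1..N}\<close>, i.e. elements of the
  library's \<open>PiM\<close> spaces. A measure \<open>\<mu>\<close> carries the measurable space \<open>\<X>\<close>.
\<close>

definition ham :: "nat \<Rightarrow> (nat \<Rightarrow> nat) \<Rightarrow> (nat \<Rightarrow> nat) \<Rightarrow> nat" where
  "ham N z w = (\<Sum>i\<in>{1..N}. of_bool (z i \<noteq> w i))"

text \<open>The subtraction below never truncates, because \<open>ham N z w \<le> N\<close>.\<close>

definition ham_star :: "nat \<Rightarrow> (nat \<Rightarrow> nat) \<Rightarrow> (nat \<Rightarrow> nat) \<Rightarrow> nat" where
  "ham_star N z w = min (ham N z w) (N - ham N z w)"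

definition estimators :: "nat \<Rightarrow> 'a measure \<Rightarrow> ((nat \<Rightarrow> 'a) \<Rightarrow> (nat \<Rightarrow> nat)) set" where
  "estimators N \<mu> = measurable (PiM {1..N} (\<lambda>_. \<mu>)) (PiM {1..N} (\<lambda>_. count_space {1, 2}))"

text \<open>Any measurable selection from the argmax is allowed, so ties may be broken arbitrarily.\<close>

definition is_MAP :: "'a measure \<Rightarrow> (nat \<Rightarrow> 'a \<Rightarrow> real) \<Rightarrow> ('a \<Rightarrow> nat) \<Rightarrow> bool" where
  "is_MAP \<mu> f t \<longleftrightarrow> t \<in> measurable \<mu> (count_space {1, 2}) \<and>
     (\<forall>x\<in>space \<mu>. is_arg_max (\<lambda>k. f k x) (\<lambda>k. k \<in> {1, 2}) (t x))"

definition coordinatewise :: "nat \<Rightarrow> ('a \<Rightarrow> nat) \<Rightarrow> (nat \<Rightarrow> 'a) \<Rightarrow> (nat \<Rightarrow> nat)" where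
  "coordinatewise N t x = (\<lambda>i\<in>{1..N}. t (x i))"

definition regular_set :: "nat \<Rightarrow> 'a measure \<Rightarrow> (nat \<Rightarrow> 'a \<Rightarrow> real) \<Rightarrow> (nat \<Rightarrow> 'a) set" where
  "regular_set N \<mu> f = {x \<in> space (PiM {1..N} (\<lambda>_. \<mu>)).
     \<forall>i\<in>{1..N}. min (f 1 (x i)) (f 2 (x i)) > 0 \<and> f 1 (x i) \<noteq> f 2 (x i)}"

end

theory Submission
  imports Defs
begin

text \<open>
  By Bayes' rule, the risk of an estimator is an integral over \<open>x\<close> of its conditional risk given the
  observations, and under that conditioning the labels are still independent: the label vector \<open>z\<close> has
  unnormalized weight \<open>\<Prod>i. f (z i) (x i) / 2\<close> (\<open>nn_integral_labels_observations\<close>). It is therefore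
  enough to show that, for every \<open>x\<close>, the MAP vector minimizes the conditional risk among all label
  vectors (\<open>posterior_ham_star_le\<close>). Working with unnormalized weights avoids conditional
  distributions and any division by the marginal density.
  
  For fixed \<open>x\<close>, let \<open>m\<close> be the MAP vector and \<open>s\<close> a competitor. Give coordinate \<open>i\<close> the value \<open>+1\<close> if
  \<open>z i = m i\<close> and \<open>-1\<close> otherwise, and let \<open>u\<close> and \<open>v\<close> be the sums of these values over the coordinates where
  \<open>s\<close> differs from \<open>m\<close> and where it agrees with \<open>m\<close>. Then \<open>Ham* = (N - \<bar>u + v\<bar>) / 2\<close> for \<open>m\<close> and
  \<open>Ham* = (N - \<bar>v - u\<bar>) / 2\<close> for \<open>s\<close>, so the claim is that \<open>h u v = \<bar>u + v\<bar> - \<bar>v - u\<bar>\<close> has nonnegative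
  mean. Here \<open>u\<close> and \<open>v\<close> are independent, and each of them stochastically dominates its reflection at \<open>0\<close>,
  because every summand favours \<open>+1\<close>. Hence every odd nondecreasing function of \<open>v\<close> alone, or of \<open>u\<close>
  alone, has nonnegative mean (\<open>margin_mean_odd_mono_nonneg\<close>). This is used twice. The function \<open>h\<close> is odd
  in each argument and has increasing differences; so for \<open>u \<le> u'\<close> the difference \<open>h u' v - h u v\<close> is odd
  and nondecreasing in \<open>v\<close>, whence the mean of \<open>h u v\<close> over \<open>v\<close> is nondecreasing in \<open>u\<close>. It is also odd in
  \<open>u\<close>, and averaging over \<open>u\<close> gives the claim (\<open>sum_margins_nonneg\<close>).
\<close>

section \<open>Signed agreement counts under product weights\<close>

definition margin :: "('i \<Rightarrow> nat) \<Rightarrow> 'i set \<Rightarrow> ('i \<Rightarrow> nat) \<Rightarrow> real" where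
  "margin m I z = (\<Sum>i\<in>I. if z i = m i then 1 else -1)"

text \<open>
  Up to normalization this is the expectation of \<open>\<phi> (margin m I z)\<close> when the labels \<open>z i\<close> are independent
  with probabilities proportional to \<open>w i\<close>.
\<close>

definition margin_mean ::
  "('i \<Rightarrow> nat \<Rightarrow> real) \<Rightarrow> ('i \<Rightarrow> nat) \<Rightarrow> 'i set \<Rightarrow> (real \<Rightarrow> real) \<Rightarrow> real" where
  "margin_mean w m I \<phi> =
     (\<Sum>z\<in>PiE I (\<lambda>_. {1, 2}). (\<Prod>i\<in>I. w i (z i)) * \<phi> (margin m I z))"

lemma margin_cong: "(\<And>i. i \<in> I \<Longrightarrow> z i = z' i) \<Longrightarrow> margin m I z = margin m I z'"
  unfolding margin_def by (rule sum.cong) auto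

lemma margin_mean_empty: "margin_mean w m {} \<phi> = \<phi> 0"
  by (simp add: margin_mean_def margin_def)

text \<open>
  Conditioning on the label of one coordinate. In \<open>{1, 2}\<close>, the label other than \<open>m i\<close> is \<open>3 - m i\<close>.
\<close>

lemma margin_mean_insert:
  assumes "finite I" "i \<notin> I" "m i \<in> {1, 2}"
  shows "margin_mean w m (insert i I) \<phi> =
    w i (m i) * margin_mean w m I (\<lambda>u. \<phi> (u + 1)) +
    w i (3 - m i) * margin_mean w m I (\<lambda>u. \<phi> (u - 1))"
proof -
  have inj: "inj_on (\<lambda>(k, z). z(i := k)) ({1, 2} \<times> PiE I (\<lambda>_. {1, 2::nat}))"
    using inj_combinator[OF assms(2), of "\<lambda>_. {1, 2::nat}"] .
  have pr: "(\<Prod>j\<in>insert i I. w j ((z(i := k)) j)) = w i k * (\<Prod>j\<in>I. w j (z j))" for k z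
    using assms by (auto intro!: prod.cong)
  have ma: "margin m (insert i I) (z(i := k)) = margin m I z + (if k = m i then 1 else -1)" for k z
  proof -
    have "margin m I (z(i := k)) = margin m I z"
      using assms by (intro margin_cong) auto
    then show ?thesis
      using assms by (simp add: margin_def)
  qed
  have labels: "{1, 2} = {m i, 3 - m i}" "m i \<noteq> 3 - m i"
    using assms(3) by auto
  have "margin_mean w m (insert i I) \<phi> = (\<Sum>(k, z)\<in>{1, 2} \<times> PiE I (\<lambda>_. {1, 2}).
      w i k * ((\<Prod>j\<in>I. w j (z j)) * \<phi> (margin m I z + (if k = m i then 1 else -1))))"
    unfolding margin_mean_def PiE_insert_eq
    by (subst sum.reindex[OF inj]) (simp only: o_def case_prod_unfold pr ma mult.assoc)
  also have "\<dots> = (\<Sum>k\<in>{m i, 3 - m i}. w i k *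
      (\<Sum>z\<in>PiE I (\<lambda>_. {1, 2}). (\<Prod>j\<in>I. w j (z j)) * \<phi> (margin m I z + (if k = m i then 1 else -1))))"
    by (simp add: sum.cartesian_product[symmetric] sum_distrib_left flip: labels(1))
  finally show ?thesis
    using labels(2) by (simp add: margin_mean_def)
qed

lemma margin_mean_mono:
  assumes "\<And>i k. i \<in> I \<Longrightarrow> k \<in> {1, 2} \<Longrightarrow> 0 \<le> w i k" "\<And>u. \<phi> u \<le> \<psi> u"
  shows "margin_mean w m I \<phi> \<le> margin_mean w m I \<psi>"
  unfolding margin_mean_def
proof (intro sum_mono mult_left_mono assms(2) prod_nonneg)
  fix z i assume "z \<in> PiE I (\<lambda>_. {1, 2::nat})" "i \<in> I"
  then show "0 \<le> w i (z i)"
    by (intro assms(1)) (auto dest: PiE_mem)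
qed

lemma margin_mean_uminus: "margin_mean w m I (\<lambda>u. - \<phi> u) = - margin_mean w m I \<phi>"
  by (simp add: margin_mean_def sum_negf)

lemma margin_mean_diff:
  "margin_mean w m I (\<lambda>u. \<phi> u - \<psi> u) = margin_mean w m I \<phi> - margin_mean w m I \<psi>"
  by (simp add: margin_mean_def sum_subtractf right_diff_distrib)

text \<open>
  If every coordinate favours \<open>m i\<close>, the margin stochastically dominates its reflection. A new
  coordinate with weights \<open>p \<ge> q\<close> shifts the margin by \<open>+1\<close> or \<open>-1\<close>: the reflected mean is
  \<open>p * E(\<phi>(-u - 1)) + q * E(\<phi>(-u + 1))\<close>, which can only grow when the larger weight moves to the larger
  value, and after that exchange the induction hypothesis applies to the two shifts of \<open>\<phi>\<close>.
\<close>

lemma margin_mean_reflect_le: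
  assumes "finite I" "mono \<phi>"
    and "\<And>i. i \<in> I \<Longrightarrow> m i \<in> {1, 2}"
    and "\<And>i k. i \<in> I \<Longrightarrow> k \<in> {1, 2} \<Longrightarrow> 0 \<le> w i k \<and> w i k \<le> w i (m i)"
  shows "margin_mean w m I (\<lambda>u. \<phi> (- u)) \<le> margin_mean w m I \<phi>"
  using assms
proof (induction I arbitrary: \<phi> rule: finite_induct)
  case empty
  then show ?case by (simp add: margin_mean_empty)
next
  case (insert i I)
  let ?E = "margin_mean w m I"
  define p q where "p = w i (m i)" and "q = w i (3 - m i)"
  have "m i \<in> {1, 2}" using insert.prems by auto
  then have "3 - m i \<in> {1, 2}" by auto
  then have pq: "0 \<le> q" "q \<le> p"
    using insert.prems(3)[of i "3 - m i"] by (auto simp: p_def q_def)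
  have "mono (\<lambda>u. \<phi> (u + c))" for c
    using insert.prems(1) by (auto simp: mono_def)
  then have IH: "?E (\<lambda>u. \<phi> (- u + c)) \<le> ?E (\<lambda>u. \<phi> (u + c))" for c
    using insert.IH[of "\<lambda>u. \<phi> (u + c)"] insert.prems by simp
  have step: "?E (\<lambda>u. \<phi> (- u - 1)) \<le> ?E (\<lambda>u. \<phi> (- u + 1))"
    using insert.prems by (intro margin_mean_mono) (auto simp: mono_def)
  have "margin_mean w m (insert i I) (\<lambda>u. \<phi> (- u)) =
      p * ?E (\<lambda>u. \<phi> (- u - 1)) + q * ?E (\<lambda>u. \<phi> (- u + 1))"
    using insert \<open>m i \<in> {1, 2}\<close> by (simp add: margin_mean_insert p_def q_def)
  also have "\<dots> \<le> p * ?E (\<lambda>u. \<phi> (- u + 1)) + q * ?E (\<lambda>u. \<phi> (- u - 1))"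
  proof -
    have "0 \<le> (p - q) * (?E (\<lambda>u. \<phi> (- u + 1)) - ?E (\<lambda>u. \<phi> (- u - 1)))"
      using pq step by simp
    then show ?thesis by (simp add: algebra_simps)
  qed
  also have "\<dots> \<le> p * ?E (\<lambda>u. \<phi> (u + 1)) + q * ?E (\<lambda>u. \<phi> (u - 1))"
    using pq IH[of 1] IH[of "-1"] by (intro add_mono mult_left_mono) auto
  also have "\<dots> = margin_mean w m (insert i I) \<phi>"
    using insert \<open>m i \<in> {1, 2}\<close> by (simp add: margin_mean_insert p_def q_def)
  finally show ?case .
qed

lemma margin_mean_odd_mono_nonneg:
  assumes "finite I" "mono \<phi>" "\<And>u. \<phi> (- u) = - \<phi> u"
    and "\<And>i. i \<in> I \<Longrightarrow> m i \<in> {1, 2}"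
    and "\<And>i k. i \<in> I \<Longrightarrow> k \<in> {1, 2} \<Longrightarrow> 0 \<le> w i k \<and> w i k \<le> w i (m i)"
  shows "0 \<le> margin_mean w m I \<phi>"
proof -
  have "margin_mean w m I (\<lambda>u. - \<phi> u) \<le> margin_mean w m I \<phi>"
    using margin_mean_reflect_le[of I \<phi> m w] assms(1,2,4,5) unfolding assms(3) by blast
  then show ?thesis
    unfolding margin_mean_uminus by linarith
qed

text \<open>
  The margins over disjoint sets of coordinates are independent, so the mean of a function of both is an
  iterated mean.
\<close>

lemma sum_margins_split:
  assumes "finite A" "finite B" "A \<inter> B = {}"
  shows "(\<Sum>z\<in>PiE (A \<union> B) (\<lambda>_. {1, 2}).
       (\<Prod>i\<in>A \<union> B. w i (z i)) * h (margin m A z) (margin m B z)) =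
     margin_mean w m A (\<lambda>u. margin_mean w m B (h u))"
proof -
  have "(\<Sum>z\<in>PiE (A \<union> B) (\<lambda>_. {1, 2}).
       (\<Prod>i\<in>A \<union> B. w i (z i)) * h (margin m A z) (margin m B z)) =
    (\<Sum>(x, y)\<in>PiE A (\<lambda>_. {1, 2}) \<times> PiE B (\<lambda>_. {1, 2}).
       (\<Prod>i\<in>A. w i (x i)) * ((\<Prod>i\<in>B. w i (y i)) * h (margin m A x) (margin m B y)))"
  proof (rule sum.reindex_bij_witness[of _ "merge A B" "\<lambda>z. (restrict z A, restrict z B)"])
    fix z assume "z \<in> PiE (A \<union> B) (\<lambda>_. {1, 2::nat})"
    then show "merge A B (restrict z A, restrict z B) = z"
      by (auto simp: merge_def PiE_def extensional_def fun_eq_iff)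
    show "(case (restrict z A, restrict z B) of (x, y) \<Rightarrow>
        (\<Prod>i\<in>A. w i (x i)) * ((\<Prod>i\<in>B. w i (y i)) * h (margin m A x) (margin m B y))) =
      (\<Prod>i\<in>A \<union> B. w i (z i)) * h (margin m A z) (margin m B z)"
      using assms margin_cong[of A "restrict z A" z m] margin_cong[of B "restrict z B" z m]
      by (simp add: prod.union_disjoint)
  next
    fix xy assume "xy \<in> PiE A (\<lambda>_. {1, 2::nat}) \<times> PiE B (\<lambda>_. {1, 2::nat})"
    then show "(restrict (merge A B xy) A, restrict (merge A B xy) B) = xy"
      and "merge A B xy \<in> PiE (A \<union> B) (\<lambda>_. {1, 2})"
      using assms(3) by (auto simp: PiE_restrict restrict_PiE_iff)
  qed (auto simp: restrict_PiE_iff)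
  also have "\<dots> = margin_mean w m A (\<lambda>u. margin_mean w m B (h u))"
    by (simp add: margin_mean_def sum.cartesian_product[symmetric] sum_distrib_left)
  finally show ?thesis .
qed

text \<open>
  Increasing differences of \<open>\<bar>u + v\<bar>\<close>, which come from the convexity of the absolute value.
\<close>

lemma abs_sum_supermodular:
  fixes u u' v v' :: real
  assumes "u \<le> u'" "v \<le> v'"
  shows "\<bar>u' + v\<bar> + \<bar>u + v'\<bar> \<le> \<bar>u + v\<bar> + \<bar>u' + v'\<bar>"
  using assms by linarith

text \<open>
  The averaging over \<open>v\<close> and then over \<open>u\<close>: the first use of the nonnegativity of odd nondecreasing means
  shows that the inner mean is monotone, so that the second use applies to the outer one.
\<close>

lemma sum_margins_nonneg:
  assumes "finite A" "finite B" "A \<inter> B = {}"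
    and "\<And>i. i \<in> A \<union> B \<Longrightarrow> m i \<in> {1, 2}"
    and "\<And>i k. i \<in> A \<union> B \<Longrightarrow> k \<in> {1, 2} \<Longrightarrow> 0 \<le> w i k \<and> w i k \<le> w i (m i)"
  shows "0 \<le> (\<Sum>z\<in>PiE (A \<union> B) (\<lambda>_. {1, 2}). (\<Prod>i\<in>A \<union> B. w i (z i)) *
    (\<bar>margin m A z + margin m B z\<bar> - \<bar>margin m B z - margin m A z\<bar>))"
proof -
  define h :: "real \<Rightarrow> real \<Rightarrow> real" where "h u v = \<bar>u + v\<bar> - \<bar>v - u\<bar>" for u v
  have odd: "h (- u) v = - h u v" "h u (- v) = - h u v" for u v
    by (auto simp: h_def)
  have odd_fun: "h (- u) = (\<lambda>v. - h u v)" for u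
    using odd(1) by blast
  have super: "h u' v - h u v \<le> h u' v' - h u v'" if "u \<le> u'" "v \<le> v'" for u u' v v'
  proof -
    \<comment> \<open>Reflecting \<open>u\<close> reverses its order, so \<open>- \<bar>v - u\<bar>\<close> has increasing differences too.\<close>
    have "\<bar>v - u\<bar> + \<bar>v' - u'\<bar> \<le> \<bar>v - u'\<bar> + \<bar>v' - u\<bar>"
      using abs_sum_supermodular[of "- u'" "- u" v v'] that by (simp only: uminus_add_conv_diff neg_le_iff_le)
    moreover have "(a - g) - (c - e) \<le> (d - f) - (b - k)"
      if "a + b \<le> c + d" "e + f \<le> g + k" for a b c d e f g k :: real
      using that by linarith
    ultimately show ?thesis
      unfolding h_def using abs_sum_supermodular[OF that] by blast
  qed
  have "mono (\<lambda>u. margin_mean w m B (h u))"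
  proof (rule monoI)
    fix u u' :: real assume "u \<le> u'"
    have "0 \<le> margin_mean w m B (\<lambda>v. h u' v - h u v)"
      using assms super[OF \<open>u \<le> u'\<close>]
      by (intro margin_mean_odd_mono_nonneg) (auto simp: mono_def odd)
    then show "margin_mean w m B (h u) \<le> margin_mean w m B (h u')"
      by (simp add: margin_mean_diff)
  qed
  then have "0 \<le> margin_mean w m A (\<lambda>u. margin_mean w m B (h u))"
    using assms by (intro margin_mean_odd_mono_nonneg) (auto simp: odd_fun margin_mean_uminus)
  then show ?thesis
    using sum_margins_split[OF assms(1-3), of w h m] by (simp add: h_def)
qed

section \<open>Optimality of the MAP labels for fixed observations\<close>

lemma ham_le: "ham N z w \<le> N"
  using sum_bounded_above[of "{1..N}" "\<lambda>i. of_bool (z i \<noteq> w i)" "1::nat"] by (simp add: ham_def)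

text \<open>
  The margin is \<open>N - 2 * Ham\<close>, and taking the smaller of \<open>Ham\<close> and \<open>N - Ham\<close> is taking the absolute value of
  the margin.
\<close>

lemma ham_star_eq:
  "real (ham_star N s z) = (real N - \<bar>margin s {1..N} z\<bar>) / 2"
proof -
  have "margin s {1..N} z = (\<Sum>i\<in>{1..N}. 1 - 2 * of_bool (s i \<noteq> z i))"
    unfolding margin_def by (rule sum.cong) auto
  then have "margin s {1..N} z = real N - 2 * real (ham N s z)"
    by (simp add: sum_subtractf ham_def sum_distrib_left)
  then show ?thesis
    using ham_le[of N s z] by (simp add: ham_star_def min_def of_nat_diff)
qed

text \<open>
  A competitor \<open>s\<close> is \<open>m\<close> with the labels on a set \<open>A\<close> flipped. The flip changes the sign of the margin over \<open>A\<close>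
  and keeps the margin over the remaining coordinates, which reduces the comparison to
  \<open>sum_margins_nonneg\<close>.
\<close>

lemma posterior_ham_star_le:
  assumes m: "\<And>i. i \<in> {1..N} \<Longrightarrow> m i \<in> {1, 2}" and s: "\<And>i. i \<in> {1..N} \<Longrightarrow> s i \<in> {1, 2}"
    and w: "\<And>i k. i \<in> {1..N} \<Longrightarrow> k \<in> {1, 2} \<Longrightarrow> 0 \<le> w i k \<and> w i k \<le> w i (m i)"
  shows "(\<Sum>z\<in>PiE {1..N} (\<lambda>_. {1, 2}). (\<Prod>i\<in>{1..N}. w i (z i)) * real (ham_star N m z)) \<le>
    (\<Sum>z\<in>PiE {1..N} (\<lambda>_. {1, 2}). (\<Prod>i\<in>{1..N}. w i (z i)) * real (ham_star N s z))"
proof -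
  define A B where "A = {i\<in>{1..N}. s i \<noteq> m i}" and "B = {i\<in>{1..N}. s i = m i}"
  have AB: "{1..N} = A \<union> B" "A \<inter> B = {}" "finite A" "finite B"
    by (auto simp: A_def B_def)
  have mm: "margin m {1..N} z = margin m A z + margin m B z" for z
    unfolding margin_def AB(1) by (rule sum.union_disjoint[OF AB(3,4,2)])
  have ms: "margin s {1..N} z = margin m B z - margin m A z"
    if z: "z \<in> PiE {1..N} (\<lambda>_. {1, 2})" for z
  proof -
    have "margin s A z = - margin m A z"
      unfolding margin_def sum_negf[symmetric]
    proof (rule sum.cong)
      fix i assume "i \<in> A"
      then have "z i \<in> {1, 2}" "m i \<in> {1, 2}" "s i \<in> {1, 2}" "s i \<noteq> m i"
        using z m s by (auto simp: A_def PiE_iff)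
      then show "(if z i = s i then 1 else -1) = - (if z i = m i then 1 else (-1::real))"
        by auto
    qed simp
    moreover have "margin s B z = margin m B z"
      unfolding margin_def by (rule sum.cong) (auto simp: B_def)
    moreover have "margin s {1..N} z = margin s A z + margin s B z"
      unfolding margin_def AB(1) by (rule sum.union_disjoint[OF AB(3,4,2)])
    ultimately show ?thesis by simp
  qed
  have "0 \<le> (\<Sum>z\<in>PiE {1..N} (\<lambda>_. {1, 2}). (\<Prod>i\<in>{1..N}. w i (z i)) *
      (\<bar>margin m A z + margin m B z\<bar> - \<bar>margin m B z - margin m A z\<bar>))"
    using sum_margins_nonneg[OF AB(3,4,2), of m w] m w unfolding AB(1) by blast
  also have "\<dots> = 2 * ((\<Sum>z\<in>PiE {1..N} (\<lambda>_. {1, 2}). (\<Prod>i\<in>{1..N}. w i (z i)) * real (ham_star N s z)) -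
      (\<Sum>z\<in>PiE {1..N} (\<lambda>_. {1, 2}). (\<Prod>i\<in>{1..N}. w i (z i)) * real (ham_star N m z)))"
    unfolding sum_subtractf[symmetric] sum_distrib_left
  proof (rule sum.cong)
    fix z assume z: "z \<in> PiE {1..N} (\<lambda>_. {1, 2::nat})"
    show "(\<Prod>i\<in>{1..N}. w i (z i)) *
        (\<bar>margin m A z + margin m B z\<bar> - \<bar>margin m B z - margin m A z\<bar>) =
      2 * ((\<Prod>i\<in>{1..N}. w i (z i)) * real (ham_star N s z) -
        (\<Prod>i\<in>{1..N}. w i (z i)) * real (ham_star N m z))"
      unfolding ham_star_eq mm ms[OF z] by (simp add: field_simps)
  qed simp
  finally show ?thesis by simp
qed

section \<open>Integrals over labels and observations\<close>

lemma (in prob_space) indep_pairs_measurable: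
  assumes "indep_vars (\<lambda>_. count_space K \<Otimes>\<^sub>M \<mu>) (\<lambda>i \<omega>. (Z i \<omega>, X i \<omega>)) I" "i \<in> I"
  shows "(\<lambda>\<omega>. (Z i \<omega>, X i \<omega>)) \<in> measurable M (count_space K \<Otimes>\<^sub>M \<mu>)"
    and "Z i \<in> measurable M (count_space K)"
    and "X i \<in> measurable M \<mu>"
proof -
  show pair: "(\<lambda>\<omega>. (Z i \<omega>, X i \<omega>)) \<in> measurable M (count_space K \<Otimes>\<^sub>M \<mu>)"
    using assms by (auto simp: indep_vars_def)
  show "Z i \<in> measurable M (count_space K)" "X i \<in> measurable M \<mu>"
    using measurable_compose[OF pair measurable_fst] measurable_compose[OF pair measurable_snd]
    by simp_all
qed

text \<open>
  On the event that the labels equal \<open>z\<close>, the observation vector has density \<open>\<Prod>i. g (z i) (x i)\<close> with respect to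
  the product measure. Both finite measures agree on boxes: by independence the mass of a box factorizes,
  and each factor is given by the law of a single pair.
\<close>

lemma nn_integral_label_event:
  fixes X :: "'i \<Rightarrow> 'w \<Rightarrow> 'a" and Z :: "'i \<Rightarrow> 'w \<Rightarrow> 'k"
    and g :: "'k \<Rightarrow> 'a \<Rightarrow> ennreal" and h :: "('i \<Rightarrow> 'a) \<Rightarrow> ennreal"
  assumes "prob_space M" "sigma_finite_measure \<mu>" "finite I"
    and indep: "prob_space.indep_vars M (\<lambda>_. count_space K \<Otimes>\<^sub>M \<mu>) (\<lambda>i \<omega>. (Z i \<omega>, X i \<omega>)) I"
    and g[measurable]: "\<And>k. k \<in> K \<Longrightarrow> g k \<in> borel_measurable \<mu>"
    and law: "\<And>i k A. i \<in> I \<Longrightarrow> k \<in> K \<Longrightarrow> A \<in> sets \<mu> \<Longrightarrow>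
      emeasure M {\<omega>\<in>space M. Z i \<omega> = k \<and> X i \<omega> \<in> A} = (\<integral>\<^sup>+x\<in>A. g k x \<partial>\<mu>)"
    and z: "\<And>i. i \<in> I \<Longrightarrow> z i \<in> K"
    and h: "h \<in> borel_measurable (PiM I (\<lambda>_. \<mu>))"
  shows "(\<integral>\<^sup>+\<omega>. (\<Prod>i\<in>I. indicator {z i} (Z i \<omega>)) * h (\<lambda>i\<in>I. X i \<omega>) \<partial>M) =
    (\<integral>\<^sup>+x. (\<Prod>i\<in>I. g (z i) (x i)) * h x \<partial>PiM I (\<lambda>_. \<mu>))"
proof -
  interpret prob_space M by fact
  interpret sigma_finite_measure \<mu> by fact
  interpret product_sigma_finite "\<lambda>_. \<mu>" by standard
  let ?J = "PiM I (\<lambda>_. \<mu>)" and ?X = "\<lambda>\<omega>. \<lambda>i\<in>I. X i \<omega>"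
  note ZX = indep_pairs_measurable(1)[OF indep] and Zm = indep_pairs_measurable(2)[OF indep]
    and Xm = indep_pairs_measurable(3)[OF indep]
  have XJ[measurable]: "?X \<in> measurable M ?J"
    using Xm by (rule measurable_restrict)
  \<comment> \<open>The indicator of the event that the labels equal \<open>z\<close>.\<close>
  define e :: "'w \<Rightarrow> ennreal" where "e \<omega> = (\<Prod>i\<in>I. indicator {z i} (Z i \<omega>))" for \<omega>
  define G where "G x = (\<Prod>i\<in>I. g (z i) (x i))" for x
  have em: "(\<lambda>\<omega>. indicator {z i} (Z i \<omega>)) \<in> borel_measurable M" if "i \<in> I" for i
    using Zm[OF that] by (rule measurable_compose) simp
  then have [measurable]: "e \<in> borel_measurable M"
    unfolding e_def by (rule borel_measurable_prod_ennreal)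
  have [measurable]: "G \<in> borel_measurable ?J"
    unfolding G_def
  proof (rule borel_measurable_prod_ennreal)
    fix i assume "i \<in> I"
    then show "(\<lambda>x. g (z i) (x i)) \<in> borel_measurable ?J"
      using g[OF z] by (intro measurable_compose[OF measurable_component_singleton]) auto
  qed
  have indic: "indicator (PiE I A) x = (\<Prod>i\<in>I. indicator (A i) (x i) :: ennreal)"
    if "x \<in> extensional I" for x :: "'i \<Rightarrow> 'a" and A
    using that \<open>finite I\<close>
    by (auto simp: indicator_def PiE_iff intro!: prod.neutral[symmetric] prod_zero[symmetric])
  have em_P: "emeasure (distr (density M e) ?J ?X) B = (\<integral>\<^sup>+\<omega>. e \<omega> * indicator B (?X \<omega>) \<partial>M)"
    if [measurable]: "B \<in> sets ?J" for B
  proof -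
    have "emeasure (distr (density M e) ?J ?X) B = (\<integral>\<^sup>+x. indicator B x \<partial>distr (density M e) ?J ?X)"
      by (rule nn_integral_indicator[symmetric]) simp
    also have "\<dots> = (\<integral>\<^sup>+\<omega>. indicator B (?X \<omega>) \<partial>density M e)"
      by (rule nn_integral_distr) simp_all
    also have "\<dots> = (\<integral>\<^sup>+\<omega>. e \<omega> * indicator B (?X \<omega>) \<partial>M)"
      by (rule nn_integral_density) simp_all
    finally show ?thesis .
  qed
  have "distr (density M e) ?J ?X = density ?J G"
  proof (rule measure_eqI_PiM_finite[OF \<open>finite I\<close>])
    fix A assume A: "\<And>i. i \<in> I \<Longrightarrow> A i \<in> sets \<mu>"
    then have [measurable]: "PiE I A \<in> sets ?J"
      using \<open>finite I\<close> by (intro sets_PiM_I_finite) auto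
    have "emeasure (distr (density M e) ?J ?X) (PiE I A) = (\<integral>\<^sup>+\<omega>. e \<omega> * indicator (PiE I A) (?X \<omega>) \<partial>M)"
      by (rule em_P) fact
    also have "\<dots> = (\<integral>\<^sup>+\<omega>. (\<Prod>i\<in>I. indicator ({z i} \<times> A i) (Z i \<omega>, X i \<omega>)) \<partial>M)"
      by (intro nn_integral_cong) (simp add: indic[OF restrict_extensional] e_def prod.distrib indicator_times)
    also have "\<dots> = (\<Prod>i\<in>I. \<integral>\<^sup>+\<omega>. indicator ({z i} \<times> A i) (Z i \<omega>, X i \<omega>) \<partial>M)"
    proof (rule indep_vars_nn_integral[OF \<open>finite I\<close>])
      show "indep_vars (\<lambda>_. borel) (\<lambda>i \<omega>. indicator ({z i} \<times> A i) (Z i \<omega>, X i \<omega>) :: ennreal) I"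
        using A z by (intro indep_vars_compose2[OF indep]) auto
    qed simp
    also have "\<dots> = (\<Prod>i\<in>I. \<integral>\<^sup>+x. g (z i) x * indicator (A i) x \<partial>\<mu>)"
    proof (rule prod.cong)
      fix i assume i: "i \<in> I"
      have meas: "{\<omega>\<in>space M. Z i \<omega> = z i \<and> X i \<omega> \<in> A i} \<in> sets M"
      proof -
        have "{\<omega>\<in>space M. Z i \<omega> = z i \<and> X i \<omega> \<in> A i} =
            (\<lambda>\<omega>. (Z i \<omega>, X i \<omega>)) -` ({z i} \<times> A i) \<inter> space M"
          by auto
        then show ?thesis
          using measurable_sets[OF ZX[OF i], of "{z i} \<times> A i"] z[OF i] A[OF i] by auto
      qed
      have "(\<integral>\<^sup>+\<omega>. indicator ({z i} \<times> A i) (Z i \<omega>, X i \<omega>) \<partial>M) =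
          (\<integral>\<^sup>+\<omega>. indicator {\<omega>\<in>space M. Z i \<omega> = z i \<and> X i \<omega> \<in> A i} \<omega> \<partial>M)"
        by (intro nn_integral_cong) (auto simp: indicator_def)
      also have "\<dots> = (\<integral>\<^sup>+x\<in>A i. g (z i) x \<partial>\<mu>)"
        using meas law[OF i z[OF i] A[OF i]] by simp
      finally show "(\<integral>\<^sup>+\<omega>. indicator ({z i} \<times> A i) (Z i \<omega>, X i \<omega>) \<partial>M) =
          (\<integral>\<^sup>+x. g (z i) x * indicator (A i) x \<partial>\<mu>)" .
    qed simp
    also have "\<dots> = (\<integral>\<^sup>+x. (\<Prod>i\<in>I. g (z i) (x i) * indicator (A i) (x i)) \<partial>?J)"
      using A z by (intro product_nn_integral_prod[symmetric] \<open>finite I\<close>) auto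
    also have "\<dots> = (\<integral>\<^sup>+x. G x * indicator (PiE I A) x \<partial>?J)"
      by (intro nn_integral_cong) (simp add: indic space_PiM PiE_iff G_def prod.distrib)
    also have "\<dots> = emeasure (density ?J G) (PiE I A)"
      by (simp add: emeasure_density)
    finally show "emeasure (distr (density M e) ?J ?X) (PiE I A) = emeasure (density ?J G) (PiE I A)" .
  next
    show "range (\<lambda>_::nat. space ?J) \<subseteq> prod_algebra I (\<lambda>_. \<mu>)"
      using space_in_prod_algebra[of I "\<lambda>_. \<mu>"] by (auto simp: space_PiM)
    have "e \<omega> \<le> 1" for \<omega>
      unfolding e_def by (intro prod_le_1) (auto simp: indicator_def)
    then have "(\<integral>\<^sup>+\<omega>. e \<omega> \<partial>M) \<le> (\<integral>\<^sup>+\<omega>. 1 \<partial>M)"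
      by (intro nn_integral_mono)
    moreover have "emeasure (distr (density M e) ?J ?X) (space ?J) = (\<integral>\<^sup>+\<omega>. e \<omega> \<partial>M)"
      unfolding em_P[OF sets.top] by (intro nn_integral_cong) (simp add: measurable_space[OF XJ])
    ultimately show "emeasure (distr (density M e) ?J ?X) (space ?J) \<noteq> \<infinity>"
      by (auto simp: emeasure_space_1 top_unique)
  qed simp_all
  then have "(\<integral>\<^sup>+x. h x \<partial>distr (density M e) ?J ?X) = (\<integral>\<^sup>+x. h x \<partial>density ?J G)"
    by simp
  then show ?thesis
    using h by (simp add: nn_integral_distr nn_integral_density e_def G_def)
qed

text \<open>
  The joint law of a pair in the form needed above: a class with prior probability \<open>1 / 2\<close> contributes
  half of its conditional density.
\<close>

lemma emeasure_label_slice: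
  fixes Z0 :: "'v \<Rightarrow> nat"
  assumes "prob_space M0"
    and Z0[measurable]: "Z0 \<in> measurable M0 (count_space {1, 2})"
    and X0[measurable]: "X0 \<in> measurable M0 \<mu>"
    and unif: "distr M0 (count_space {1, 2}) Z0 = uniform_count_measure {1, 2}"
    and dist: "distributed (uniform_measure M0 {\<omega> \<in> space M0. Z0 \<omega> = k}) \<mu> X0 f"
    and k: "k \<in> {1, 2}" and A: "A \<in> sets \<mu>"
  shows "emeasure M0 {\<omega>\<in>space M0. Z0 \<omega> = k \<and> X0 \<omega> \<in> A} = (\<integral>\<^sup>+x\<in>A. f x / 2 \<partial>\<mu>)"
proof -
  let ?E = "{\<omega> \<in> space M0. Z0 \<omega> = k}"
  have [measurable]: "f \<in> borel_measurable \<mu>"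
    using dist by (simp add: distributed_def)
  have E_eq: "?E = Z0 -` {k} \<inter> space M0" by auto
  then have E: "?E \<in> sets M0"
    using k by simp
  have "emeasure M0 ?E = emeasure (distr M0 (count_space {1, 2}) Z0) {k}"
    using k by (subst emeasure_distr[OF Z0]) (auto simp: E_eq)
  also have "\<dots> = ennreal (1 / 2)"
    using k unfolding unif by (subst emeasure_uniform_count_measure) auto
  finally have half: "emeasure M0 ?E = ennreal (1 / 2)" .
  have P: "X0 -` A \<inter> space M0 \<in> sets M0"
    using X0 A by (rule measurable_sets)
  have "(\<integral>\<^sup>+x. f x * indicator A x \<partial>\<mu>) = emeasure M0 (?E \<inter> (X0 -` A \<inter> space M0)) / ennreal (1 / 2)"
    using distributed_emeasure[OF dist A] E half P by simp
  moreover have "?E \<inter> (X0 -` A \<inter> space M0) = {\<omega>\<in>space M0. Z0 \<omega> = k \<and> X0 \<omega> \<in> A}"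
    by auto
  ultimately have "(\<integral>\<^sup>+x. f x * indicator A x \<partial>\<mu>) / 2 =
      emeasure M0 {\<omega>\<in>space M0. Z0 \<omega> = k \<and> X0 \<omega> \<in> A} / ennreal (1 / 2) / ennreal 2"
    by simp
  also have "\<dots> = emeasure M0 {\<omega>\<in>space M0. Z0 \<omega> = k \<and> X0 \<omega> \<in> A}"
  proof (cases "emeasure M0 {\<omega>\<in>space M0. Z0 \<omega> = k \<and> X0 \<omega> \<in> A}")
    case (real c)
    have "ennreal c / ennreal (1 / 2) / ennreal 2 = ennreal (c / (1 / 2) / 2)"
      using divide_ennreal[of c "1 / 2"] divide_ennreal[of "c / (1 / 2)" 2] real(1)
      by (simp only: divide_nonneg_pos zero_less_numeral zero_less_divide_1_iff)
    then show ?thesis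
      unfolding real(2) by simp
  qed (simp add: ennreal_top_divide)
  finally have "emeasure M0 {\<omega>\<in>space M0. Z0 \<omega> = k \<and> X0 \<omega> \<in> A} =
      (\<integral>\<^sup>+x. f x * indicator A x \<partial>\<mu>) / 2"
    by simp
  also have "\<dots> = (\<integral>\<^sup>+x. f x * indicator A x / 2 \<partial>\<mu>)"
    using A by (intro nn_integral_divide[symmetric]) simp
  also have "\<dots> = (\<integral>\<^sup>+x\<in>A. f x / 2 \<partial>\<mu>)"
    by (simp add: divide_ennreal_def mult_ac)
  finally show ?thesis .
qed


text \<open>
  There are finitely many label vectors, so a function of labels and observations is a finite sum over
  the events that the labels equal \<open>z\<close>; this gives its measurability and, with the densities on these
  events, its integral.
\<close>

lemma
  fixes X :: "'i \<Rightarrow> 'w \<Rightarrow> 'a" and Z :: "'i \<Rightarrow> 'w \<Rightarrow> 'k"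
    and g :: "'k \<Rightarrow> 'a \<Rightarrow> ennreal" and H :: "('i \<Rightarrow> 'k) \<Rightarrow> ('i \<Rightarrow> 'a) \<Rightarrow> ennreal"
  assumes M: "prob_space M" "sigma_finite_measure \<mu>" "finite I" and "finite K"
    and indep: "prob_space.indep_vars M (\<lambda>_. count_space K \<Otimes>\<^sub>M \<mu>) (\<lambda>i \<omega>. (Z i \<omega>, X i \<omega>)) I"
    and g: "\<And>k. k \<in> K \<Longrightarrow> g k \<in> borel_measurable \<mu>"
    and law: "\<And>i k A. i \<in> I \<Longrightarrow> k \<in> K \<Longrightarrow> A \<in> sets \<mu> \<Longrightarrow>
      emeasure M {\<omega>\<in>space M. Z i \<omega> = k \<and> X i \<omega> \<in> A} = (\<integral>\<^sup>+x\<in>A. g k x \<partial>\<mu>)"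
    and H[measurable]: "\<And>z. z \<in> PiE I (\<lambda>_. K) \<Longrightarrow> H z \<in> borel_measurable (PiM I (\<lambda>_. \<mu>))"
  shows borel_measurable_labels_observations:
      "(\<lambda>\<omega>. H (\<lambda>i\<in>I. Z i \<omega>) (\<lambda>i\<in>I. X i \<omega>)) \<in> borel_measurable M" (is ?meas)
    and nn_integral_labels_observations:
      "(\<integral>\<^sup>+\<omega>. H (\<lambda>i\<in>I. Z i \<omega>) (\<lambda>i\<in>I. X i \<omega>) \<partial>M) =
        (\<integral>\<^sup>+x. (\<Sum>z\<in>PiE I (\<lambda>_. K). (\<Prod>i\<in>I. g (z i) (x i)) * H z x) \<partial>PiM I (\<lambda>_. \<mu>))" (is ?int)
proof -
  interpret prob_space M by fact
  let ?J = "PiM I (\<lambda>_. \<mu>)" and ?Z = "\<lambda>\<omega>. \<lambda>i\<in>I. Z i \<omega>" and ?X = "\<lambda>\<omega>. \<lambda>i\<in>I. X i \<omega>"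
  define e :: "('i \<Rightarrow> 'k) \<Rightarrow> 'w \<Rightarrow> ennreal" where "e z \<omega> = (\<Prod>i\<in>I. indicator {z i} (Z i \<omega>))" for z \<omega>
  note Zm = indep_pairs_measurable(2)[OF indep] and Xm = indep_pairs_measurable(3)[OF indep]
  have [measurable]: "?X \<in> measurable M ?J"
    using Xm by (rule measurable_restrict)
  have em: "e z \<in> borel_measurable M" for z
    unfolding e_def
  proof (rule borel_measurable_prod_ennreal)
    fix i assume "i \<in> I"
    from Zm[OF this] show "(\<lambda>\<omega>. indicator {z i} (Z i \<omega>)) \<in> borel_measurable M"
      by (rule measurable_compose) simp
  qed
  have term_m: "(\<lambda>\<omega>. e z \<omega> * H z (?X \<omega>)) \<in> borel_measurable M" if "z \<in> PiE I (\<lambda>_. K)" for z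
    using em H[OF that] by measurable
  have fin: "finite (PiE I (\<lambda>_. K))"
    using \<open>finite I\<close> \<open>finite K\<close> by (rule finite_PiE)
  have decomp: "H (?Z \<omega>) (?X \<omega>) = (\<Sum>z\<in>PiE I (\<lambda>_. K). e z \<omega> * H z (?X \<omega>))" if "\<omega> \<in> space M" for \<omega>
  proof -
    have mem: "?Z \<omega> \<in> PiE I (\<lambda>_. K)"
      using measurable_space[OF Zm that] by auto
    have "e z \<omega> = (if z = ?Z \<omega> then 1 else 0)" if z: "z \<in> PiE I (\<lambda>_. K)" for z
    proof (cases "z = ?Z \<omega>")
      case True
      then show ?thesis by (simp add: e_def)
    next
      case False
      then obtain i where "i \<in> I" "z i \<noteq> Z i \<omega>"
        using z mem PiE_ext[OF z mem] by auto
      then show ?thesis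
        using False \<open>finite I\<close> by (auto simp: e_def indicator_def)
    qed
    then have "(\<Sum>z\<in>PiE I (\<lambda>_. K). e z \<omega> * H z (?X \<omega>)) =
        (\<Sum>z\<in>PiE I (\<lambda>_. K). if z = ?Z \<omega> then H z (?X \<omega>) else 0)"
      by (intro sum.cong) auto
    also have "\<dots> = H (?Z \<omega>) (?X \<omega>)"
      using mem fin by (simp only: sum.delta if_True)
    finally show ?thesis by simp
  qed
  show ?meas
    by (subst measurable_cong[OF decomp]) (use term_m in \<open>simp_all add: borel_measurable_sum\<close>)
  have Gm: "(\<lambda>x. \<Prod>i\<in>I. g (z i) (x i)) \<in> borel_measurable ?J" if "z \<in> PiE I (\<lambda>_. K)" for z
  proof (rule borel_measurable_prod_ennreal)
    fix i assume "i \<in> I"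
    then show "(\<lambda>x. g (z i) (x i)) \<in> borel_measurable ?J"
      using g PiE_mem[OF that] by (intro measurable_compose[OF measurable_component_singleton]) auto
  qed
  have "(\<integral>\<^sup>+\<omega>. H (?Z \<omega>) (?X \<omega>) \<partial>M) = (\<integral>\<^sup>+\<omega>. (\<Sum>z\<in>PiE I (\<lambda>_. K). e z \<omega> * H z (?X \<omega>)) \<partial>M)"
    using decomp by (rule nn_integral_cong)
  also have "\<dots> = (\<Sum>z\<in>PiE I (\<lambda>_. K). \<integral>\<^sup>+\<omega>. e z \<omega> * H z (?X \<omega>) \<partial>M)"
    using term_m by (rule nn_integral_sum)
  also have "\<dots> = (\<Sum>z\<in>PiE I (\<lambda>_. K). \<integral>\<^sup>+x. (\<Prod>i\<in>I. g (z i) (x i)) * H z x \<partial>?J)"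
    unfolding e_def
  proof (rule sum.cong)
    fix z assume z: "z \<in> PiE I (\<lambda>_. K)"
    show "(\<integral>\<^sup>+\<omega>. (\<Prod>i\<in>I. indicator {z i} (Z i \<omega>)) * H z (?X \<omega>) \<partial>M) =
        (\<integral>\<^sup>+x. (\<Prod>i\<in>I. g (z i) (x i)) * H z x \<partial>?J)"
      by (rule nn_integral_label_event[OF M indep g law PiE_mem[OF z] H[OF z]])
  qed simp
  also have "\<dots> = (\<integral>\<^sup>+x. (\<Sum>z\<in>PiE I (\<lambda>_. K). (\<Prod>i\<in>I. g (z i) (x i)) * H z x) \<partial>?J)"
    by (rule nn_integral_sum[symmetric]) (rule borel_measurable_times_ennreal[OF Gm H])
  finally show ?int .
qed

section \<open>Bayes optimality of the coordinatewise MAP estimator\<close>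

lemma measurable_ham_star:
  assumes t: "t \<in> estimators N \<mu>"
  shows "(\<lambda>x. real (ham_star N (t x) z)) \<in> borel_measurable (PiM {1..N} (\<lambda>_. \<mu>))"
proof -
  have "(\<lambda>x. if z i = t x i then 1 else -1 :: real) \<in> borel_measurable (PiM {1..N} (\<lambda>_. \<mu>))"
    if "i \<in> {1..N}" for i
  proof -
    have "(\<lambda>x. t x i) \<in> measurable (PiM {1..N} (\<lambda>_. \<mu>)) (count_space {1, 2})"
      by (rule measurable_compose[OF t[unfolded estimators_def]
            measurable_component_singleton[OF that]])
    then show ?thesis
      by (rule measurable_compose) simp
  qed
  then show ?thesis
    unfolding ham_star_eq margin_def by (intro borel_measurable_divide borel_measurable_diff
      borel_measurable_abs borel_measurable_sum borel_measurable_const)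
qed

lemma is_MAP_max:
  assumes "is_MAP \<mu> f t" "x \<in> space \<mu>"
  shows "t x \<in> {1, 2}" and "k \<in> {1, 2} \<Longrightarrow> f k x \<le> f (t x) x"
  using assms unfolding is_MAP_def is_arg_max_def by (blast, force simp: not_less)

theorem proposition1:
  fixes \<mu> :: "'a measure"
    and f :: "nat \<Rightarrow> 'a \<Rightarrow> real"
    and M0 :: "'v measure" and Z0 :: "'v \<Rightarrow> nat" and X0 :: "'v \<Rightarrow> 'a"
    and M :: "'w measure" and Z :: "nat \<Rightarrow> 'w \<Rightarrow> nat" and X :: "nat \<Rightarrow> 'w \<Rightarrow> 'a"
    and N :: nat
    and tMAP :: "'a \<Rightarrow> nat"
  assumes "sigma_finite_measure \<mu>"
    and "prob_space M0"
    and "Z0 \<in> measurable M0 (count_space {1, 2})"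
    and "X0 \<in> measurable M0 \<mu>"
    and "distr M0 (count_space {1, 2}) Z0 = uniform_count_measure {1, 2}"
    and "\<And>k. k \<in> {1, 2} \<Longrightarrow> f k \<in> borel_measurable \<mu>"
    and "\<And>k x. k \<in> {1, 2} \<Longrightarrow> x \<in> space \<mu> \<Longrightarrow> f k x \<ge> 0"
    and "\<And>k. k \<in> {1, 2} \<Longrightarrow>
           distributed (uniform_measure M0 {\<omega> \<in> space M0. Z0 \<omega> = k}) \<mu> X0 (\<lambda>x. ennreal (f k x))"
    and "prob_space M"
    and "prob_space.indep_vars M (\<lambda>_. count_space {1, 2} \<Otimes>\<^sub>M \<mu>) (\<lambda>i \<omega>. (Z i \<omega>, X i \<omega>)) {1..N}"
    and "\<And>i. i \<in> {1..N} \<Longrightarrow>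
           distr M (count_space {1, 2} \<Otimes>\<^sub>M \<mu>) (\<lambda>\<omega>. (Z i \<omega>, X i \<omega>)) =
           distr M0 (count_space {1, 2} \<Otimes>\<^sub>M \<mu>) (\<lambda>\<omega>. (Z0 \<omega>, X0 \<omega>))"
    and "measure (distr M (PiM {1..N} (\<lambda>_. \<mu>)) (\<lambda>\<omega>. \<lambda>i\<in>{1..N}. X i \<omega>)) (regular_set N \<mu> f) = 1"
    and "is_MAP \<mu> f tMAP"
  shows "is_arg_min
           (\<lambda>t. \<integral>\<omega>. real (ham_star N (t (\<lambda>i\<in>{1..N}. X i \<omega>)) (\<lambda>i\<in>{1..N}. Z i \<omega>)) \<partial>M)
           (\<lambda>t. t \<in> estimators N \<mu>)
           (coordinatewise N tMAP)"
proof -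
  interpret prob_space M by fact
  let ?J = "PiM {1..N} (\<lambda>_. \<mu>)" and ?P = "count_space {1, 2} \<Otimes>\<^sub>M \<mu>"
  let ?Z = "\<lambda>\<omega>. \<lambda>i\<in>{1..N}. Z i \<omega>" and ?X = "\<lambda>\<omega>. \<lambda>i\<in>{1..N}. X i \<omega>"
  let ?L = "\<lambda>t \<omega>. real (ham_star N (t (?X \<omega>)) (?Z \<omega>))"
  let ?S = "\<lambda>t x. \<Sum>z\<in>PiE {1..N} (\<lambda>_. {1, 2}).
    (\<Prod>i\<in>{1..N}. f (z i) (x i) / 2) * real (ham_star N (t x) z)"
  note indep = assms(10)
  have law: "emeasure M {\<omega>\<in>space M. Z i \<omega> = k \<and> X i \<omega> \<in> A} = (\<integral>\<^sup>+x\<in>A. ennreal (f k x) / 2 \<partial>\<mu>)"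
    if i: "i \<in> {1..N}" and k: "k \<in> {1, 2}" and A: "A \<in> sets \<mu>" for i k A
  proof -
    have pair0: "(\<lambda>\<omega>. (Z0 \<omega>, X0 \<omega>)) \<in> measurable M0 ?P"
      using assms(3,4) by (rule measurable_Pair)
    have kA: "{k} \<times> A \<in> sets ?P"
      using k A by (intro pair_measureI) auto
    have "{\<omega>\<in>space M. Z i \<omega> = k \<and> X i \<omega> \<in> A} = (\<lambda>\<omega>. (Z i \<omega>, X i \<omega>)) -` ({k} \<times> A) \<inter> space M"
      by auto
    then have "emeasure M {\<omega>\<in>space M. Z i \<omega> = k \<and> X i \<omega> \<in> A} =
        emeasure (distr M ?P (\<lambda>\<omega>. (Z i \<omega>, X i \<omega>))) ({k} \<times> A)"
      using emeasure_distr[OF indep_pairs_measurable(1)[OF indep i] kA] by simp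
    also have "\<dots> = emeasure (distr M0 ?P (\<lambda>\<omega>. (Z0 \<omega>, X0 \<omega>))) ({k} \<times> A)"
      using assms(11)[OF i] by simp
    also have "\<dots> = emeasure M0 ((\<lambda>\<omega>. (Z0 \<omega>, X0 \<omega>)) -` ({k} \<times> A) \<inter> space M0)"
      by (rule emeasure_distr[OF pair0 kA])
    also have "(\<lambda>\<omega>. (Z0 \<omega>, X0 \<omega>)) -` ({k} \<times> A) \<inter> space M0 =
        {\<omega>\<in>space M0. Z0 \<omega> = k \<and> X0 \<omega> \<in> A}"
      by auto
    also have "emeasure M0 \<dots> = (\<integral>\<^sup>+x\<in>A. ennreal (f k x) / 2 \<partial>\<mu>)"
      by (rule emeasure_label_slice[OF assms(2-5) assms(8)[OF k] k A])
    finally show ?thesis .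
  qed
  have f_meas: "(\<lambda>x. ennreal (f k x) / 2) \<in> borel_measurable \<mu>" if "k \<in> {1, 2}" for k
    using assms(6)[OF that] by simp
  have f_nonneg: "0 \<le> f (z i) (x i)"
    if "x \<in> space ?J" "z \<in> PiE {1..N} (\<lambda>_. {1, 2})" "i \<in> {1..N}" for x z i
    using PiE_mem[OF that(2,3)] PiE_mem[OF that(1)[unfolded space_PiM] that(3)] by (rule assms(7))
  \<comment> \<open>The risk of \<open>t\<close> as an integral of the unnormalized conditional risk \<open>?S t\<close> given the
    observations.\<close>
  have L_meas: "?L t \<in> borel_measurable M"
    and L_int: "(\<integral>\<^sup>+\<omega>. ennreal (?L t \<omega>) \<partial>M) = (\<integral>\<^sup>+x. ennreal (?S t x) \<partial>?J)"
    if t: "t \<in> estimators N \<mu>" for t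
  proof -
    note M = assms(9,1) finite_atLeastAtMost[of 1 N]
    have K: "finite {1, 2::nat}"
      by simp
    have H: "(\<lambda>x. ennreal (real (ham_star N (t x) z))) \<in> borel_measurable ?J" for z
      using measurable_ham_star[OF t] by simp
    have "(\<lambda>\<omega>. ennreal (?L t \<omega>)) \<in> borel_measurable M"
      by (rule borel_measurable_labels_observations[OF M K indep f_meas law H])
    then have "(\<lambda>\<omega>. enn2real (ennreal (?L t \<omega>))) \<in> borel_measurable M"
      by measurable
    then show "?L t \<in> borel_measurable M"
      by simp
    have "(\<integral>\<^sup>+\<omega>. ennreal (?L t \<omega>) \<partial>M) = (\<integral>\<^sup>+x. (\<Sum>z\<in>PiE {1..N} (\<lambda>_. {1, 2}).
        (\<Prod>i\<in>{1..N}. ennreal (f (z i) (x i)) / 2) * ennreal (real (ham_star N (t x) z))) \<partial>?J)"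
      by (rule nn_integral_labels_observations[OF M K indep f_meas law H])
    also have "\<dots> = (\<integral>\<^sup>+x. ennreal (?S t x) \<partial>?J)"
    proof (rule nn_integral_cong)
      fix x assume x: "x \<in> space ?J"
      have term_eq: "(\<Prod>i\<in>{1..N}. ennreal (f (z i) (x i)) / 2) * ennreal (real (ham_star N (t x) z)) =
          ennreal ((\<Prod>i\<in>{1..N}. f (z i) (x i) / 2) * real (ham_star N (t x) z))"
        and nonneg: "0 \<le> (\<Prod>i\<in>{1..N}. f (z i) (x i) / 2) * real (ham_star N (t x) z)"
        if z: "z \<in> PiE {1..N} (\<lambda>_. {1, 2})" for z
      proof -
        have pos: "0 \<le> (\<Prod>i\<in>{1..N}. f (z i) (x i) / 2)"
          using f_nonneg[OF x z] by (intro prod_nonneg) simp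
        then show "0 \<le> (\<Prod>i\<in>{1..N}. f (z i) (x i) / 2) * real (ham_star N (t x) z)"
          by simp
        have "ennreal (f (z i) (x i)) / 2 = ennreal (f (z i) (x i) / 2)" if "i \<in> {1..N}" for i
          using divide_ennreal[OF f_nonneg[OF x z that], of 2] by simp
        then have "(\<Prod>i\<in>{1..N}. ennreal (f (z i) (x i)) / 2) =
            (\<Prod>i\<in>{1..N}. ennreal (f (z i) (x i) / 2))"
          by (intro prod.cong refl)
        also have "\<dots> = ennreal (\<Prod>i\<in>{1..N}. f (z i) (x i) / 2)"
          using f_nonneg[OF x z] by (intro prod_ennreal) simp
        finally show "(\<Prod>i\<in>{1..N}. ennreal (f (z i) (x i)) / 2) *
              ennreal (real (ham_star N (t x) z)) =
            ennreal ((\<Prod>i\<in>{1..N}. f (z i) (x i) / 2) * real (ham_star N (t x) z))"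
          using pos by (simp only: ennreal_mult of_nat_0_le_iff)
      qed
      have "(\<Sum>z\<in>PiE {1..N} (\<lambda>_. {1, 2}).
          (\<Prod>i\<in>{1..N}. ennreal (f (z i) (x i)) / 2) * ennreal (real (ham_star N (t x) z))) =
          (\<Sum>z\<in>PiE {1..N} (\<lambda>_. {1, 2}).
          ennreal ((\<Prod>i\<in>{1..N}. f (z i) (x i) / 2) * real (ham_star N (t x) z)))"
        by (rule sum.cong[OF refl term_eq])
      also have "\<dots> = ennreal (?S t x)"
        by (rule sum_ennreal[OF nonneg])
      finally show "(\<Sum>z\<in>PiE {1..N} (\<lambda>_. {1, 2}).
          (\<Prod>i\<in>{1..N}. ennreal (f (z i) (x i)) / 2) * ennreal (real (ham_star N (t x) z))) =
          ennreal (?S t x)" .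
    qed
    finally show "(\<integral>\<^sup>+\<omega>. ennreal (?L t \<omega>) \<partial>M) = (\<integral>\<^sup>+x. ennreal (?S t x) \<partial>?J)" .
  qed
  have MAP: "coordinatewise N tMAP \<in> estimators N \<mu>"
    unfolding estimators_def coordinatewise_def
  proof (rule measurable_restrict)
    fix i assume i: "i \<in> {1..N}"
    have "tMAP \<in> measurable \<mu> (count_space {1, 2})"
      using assms(13) by (simp add: is_MAP_def)
    with measurable_component_singleton[OF i]
    show "(\<lambda>x. tMAP (x i)) \<in> measurable ?J (count_space {1, 2})"
      by (rule measurable_compose)
  qed
  have "(\<integral>\<omega>. ?L (coordinatewise N tMAP) \<omega> \<partial>M) \<le> (\<integral>\<omega>. ?L t \<omega> \<partial>M)"
    if t: "t \<in> estimators N \<mu>" for t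
  proof -
    have le: "?S (coordinatewise N tMAP) x \<le> ?S t x" if x: "x \<in> space ?J" for x
    proof (rule posterior_ham_star_le)
      fix i assume i: "i \<in> {1..N}"
      then have xi: "x i \<in> space \<mu>"
        using x by (auto simp: space_PiM)
      have m: "coordinatewise N tMAP x i = tMAP (x i)"
        using i by (simp add: coordinatewise_def)
      show "coordinatewise N tMAP x i \<in> {1, 2}"
        unfolding m by (rule is_MAP_max[OF assms(13) xi])
      have "t x \<in> PiE {1..N} (\<lambda>_. {1, 2})"
        using measurable_space[OF t[unfolded estimators_def] x] by (simp add: space_PiM)
      then show "t x i \<in> {1, 2}"
        using i by (rule PiE_mem)
      fix k :: nat assume k: "k \<in> {1, 2}"
      show "0 \<le> f k (x i) / 2 \<and> f k (x i) / 2 \<le> f (coordinatewise N tMAP x i) (x i) / 2"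
        unfolding m using assms(7)[OF k xi] is_MAP_max(2)[OF assms(13) xi k] by simp
    qed
    \<comment> \<open>Finiteness is needed because \<open>enn2real\<close> is monotone only below infinity.\<close>
    have fin: "(\<integral>\<^sup>+\<omega>. ennreal (?L t \<omega>) \<partial>M) < \<top>"
    proof -
      have "(\<integral>\<^sup>+\<omega>. ennreal (?L t \<omega>) \<partial>M) \<le> (\<integral>\<^sup>+\<omega>. ennreal (real N) \<partial>M)"
        by (intro nn_integral_mono ennreal_leI) (simp add: ham_star_def min_le_iff_disj)
      also have "\<dots> < \<top>"
        by (simp add: emeasure_space_1)
      finally show ?thesis .
    qed
    have "(\<integral>\<^sup>+\<omega>. ennreal (?L (coordinatewise N tMAP) \<omega>) \<partial>M) \<le> (\<integral>\<^sup>+\<omega>. ennreal (?L t \<omega>) \<partial>M)"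
      unfolding L_int[OF MAP] L_int[OF t] by (intro nn_integral_mono ennreal_leI le)
    then have "enn2real (\<integral>\<^sup>+\<omega>. ennreal (?L (coordinatewise N tMAP) \<omega>) \<partial>M) \<le>
        enn2real (\<integral>\<^sup>+\<omega>. ennreal (?L t \<omega>) \<partial>M)"
      using fin by (rule enn2real_mono)
    then show ?thesis
      using L_meas[OF t] L_meas[OF MAP] by (simp add: integral_eq_nn_integral)
  qed
  then show ?thesis
    using MAP unfolding is_arg_min_def by (meson not_less)
qed

end
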